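(* Let $p\in(0,1]$. For all $0\le t<1/2$, $G_{p,n}(\lfloor nt\rfloor)=O_{\mathbb P}(1)$ as $n\to\infty$; that is, the sequence of random variables $(G_{p,n}(\lfloor nt\rfloor))_{n}$ is bounded in probability (tight).
   Context: Discrete $p$-frozen model. Fix $p\in(0,1]$. For an integer $n\ge 2$ the random (multi)graph process $(F_{p,n}(m))_{m\in\mathbb Z_+}$ on vertex set $\{1,\dots,n\}$ is defined recursively. All its connected components are either trees (number of edges = number of vertices minus one) or unicycles (number of edges = number of vertices); vertices of unicycles are called frozen. $F_{p,n}(0)$ has $n$ isolated non-frozen vertices. At step $m\ge 1$, given $F_{p,n}(m-1)$, one of the $n(n-1)/2$ possible edges is selected uniformly at random, independently of the past (the same edge may be selected several times), and: (i) if it connects two vertices of trees of $F_{p,n}(m-1)$ (possibly the same tree), it is added; if two different trees are involved this produces a new tree (non-frozen), otherwise it produces a unicycle whose vertices become frozen (if the selected edge is already present in the tree, it is added as a parallel edge, creating a cycle of length two); (ii) if it connects two vertices of unicycles (possibly the same), it is discarded; (iii) if it connects a tree and a unicycle, it is added with probability $p$ (the tree is glued to the unicycle and all its vertices become frozen) and discarded with probability $1-p$. Notation: $G_{p,n}(m)$ is the number of frozen vertices of $F_{p,n}(m)$. *)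

theory Defs
  imports "HOL-Probability.Probability" "HOL-Library.Multiset"
begin

text \<open>
  Multigraphs are multisets of edges; the vertex set \<open>{1..n}\<close> is kept separate. An unordered edge
  is represented by the pair of its endpoints in increasing order. (Pairs of naturals rather than
  two-element sets of naturals, so that edges and multigraphs form countable types and every
  functional of finitely many random edges is measurable.)
\<close>

type_synonym edge = "nat \<times> nat"
type_synonym multigraph = "edge multiset"

definition possible_edges :: "nat \<Rightarrow> edge set" where
  "possible_edges n = {(u, v). 1 \<le> u \<and> u < v \<and> v \<le> n}"

definition adjacency :: "multigraph \<Rightarrow> (nat \<times> nat) set" where
  "adjacency M = {(u, v). (u, v) \<in># M \<or> (v, u) \<in># M}"

definition component :: "multigraph \<Rightarrow> nat \<Rightarrow> nat set" where
  "component M v = {w. (v, w) \<in> (adjacency M)\<^sup>*}"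

definition edges_within :: "multigraph \<Rightarrow> nat set \<Rightarrow> multigraph" where
  "edges_within M C = {#e \<in># M. fst e \<in> C \<and> snd e \<in> C#}"

text \<open>The next two notions are applied to connected components only; \<open>size\<close> counts parallel edges.\<close>

definition is_tree :: "multigraph \<Rightarrow> nat set \<Rightarrow> bool" where
  "is_tree M C \<longleftrightarrow> size (edges_within M C) + 1 = card C"

definition is_unicycle :: "multigraph \<Rightarrow> nat set \<Rightarrow> bool" where
  "is_unicycle M C \<longleftrightarrow> size (edges_within M C) = card C"

definition in_tree :: "multigraph \<Rightarrow> nat \<Rightarrow> bool" where
  "in_tree M v \<longleftrightarrow> is_tree M (component M v)"

definition frozen :: "multigraph \<Rightarrow> nat \<Rightarrow> bool" where
  "frozen M v \<longleftrightarrow> is_unicycle M (component M v)"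

text \<open>
  One step with selected edge \<open>(u, v)\<close>; the Boolean is the outcome of the coin that decides whether
  an edge between a tree and a unicycle is kept.
\<close>

fun frozen_step :: "multigraph \<Rightarrow> edge \<times> bool \<Rightarrow> multigraph" where
  "frozen_step M ((u, v), keep) =
     (if in_tree M u \<and> in_tree M v then add_mset (u, v) M
      else if frozen M u \<and> frozen M v then M
      else if keep then add_mset (u, v) M
      else M)"

text \<open>
  The probability space carries one independent pair per step: a uniform edge and an independent
  coin with success probability \<open>p\<close>. Coordinate \<open>m\<close> drives the transition from time \<open>m\<close> to
  time \<open>Suc m\<close>. The coin is tossed at every step but only consulted for an edge joining a tree
  and a unicycle.
\<close>

definition frozen_space :: "real \<Rightarrow> nat \<Rightarrow> (nat \<Rightarrow> edge \<times> bool) measure" where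
  "frozen_space p n =
     Pi\<^sub>M UNIV (\<lambda>m. measure_pmf (pair_pmf (pmf_of_set (possible_edges n)) (bernoulli_pmf p)))"

text \<open>
  The \<open>p\<close>-frozen process on \<open>{1..n}\<close>, as a function on \<open>frozen_space p n\<close>; the parameters \<open>p\<close>
  and \<open>n\<close> enter only through that measure.
\<close>

primrec frozen_process :: "nat \<Rightarrow> (nat \<Rightarrow> edge \<times> bool) \<Rightarrow> multigraph" where
  "frozen_process 0 \<omega> = {#}"
| "frozen_process (Suc m) \<omega> = frozen_step (frozen_process m \<omega>) (\<omega> m)"

definition num_frozen :: "nat \<Rightarrow> nat \<Rightarrow> (nat \<Rightarrow> edge \<times> bool) \<Rightarrow> nat" where
  "num_frozen n m \<omega> = card {v \<in> {1..n}. frozen (frozen_process m \<omega>) v}"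

definition num_frozen_law :: "real \<Rightarrow> nat \<Rightarrow> nat \<Rightarrow> real measure" where
  "num_frozen_law p n m = distr (frozen_space p n) borel (\<lambda>\<omega>. real (num_frozen n m \<omega>))"

end

theory Submission
  imports Defs
begin

text \<open>
  A frozen vertex lies in a component with as many edges as vertices, so some trail starting at it
  (using each selected edge, i.e. each time index, at most once) ends in a vertex that it has
  already visited. A fixed trail of \<open>k\<close> steps has probability at most \<open>(2 / (n (n - 1)))\<^sup>k\<close>, and up to
  time \<open>m\<close> there are at most \<open>n\<^sup>k m\<^sup>k k\<close> candidates. Hence the expected number of frozen vertices is
  at most \<open>\<Sum>k. k (2 m / (n - 1))\<^sup>k\<close>, which stays bounded if \<open>m \<le> n t\<close> with \<open>t < 1 / 2\<close>,
  and Markov's inequality gives tightness.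
\<close>

section \<open>Trails\<close>

definition joins :: "'a \<times> 'a \<Rightarrow> 'a \<Rightarrow> 'a \<Rightarrow> bool" where
  "joins x a b \<longleftrightarrow> x = (a, b) \<or> x = (b, a)"

lemma joins_commute: "joins x a b \<longleftrightarrow> joins x b a"
  by (auto simp: joins_def)

text \<open>A walk is its start vertex with the list of edge indices and vertices visited next.\<close>

fun walk_steps :: "'a \<Rightarrow> ('i \<times> 'a) list \<Rightarrow> ('i \<times> 'a \<times> 'a) list" where
  "walk_steps v [] = []"
| "walk_steps v ((i, w) # s) = (i, v, w) # walk_steps w s"

definition walk :: "('i \<Rightarrow> 'a \<times> 'a) \<Rightarrow> 'a \<Rightarrow> ('i \<times> 'a) list \<Rightarrow> bool" where
  "walk e v s \<longleftrightarrow> (\<forall>(i, a, b) \<in> set (walk_steps v s). joins (e i) a b)"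

definition walk_end :: "'a \<Rightarrow> ('i \<times> 'a) list \<Rightarrow> 'a" where
  "walk_end v s = last (v # map snd s)"

text \<open>Distinctness is asked of the indices, not of the edges \<open>e i\<close>. Parallel
  edges thus stay different, so a cycle of length two is a trail, and when indices are times the
  steps of a trail read different coordinates of the random input.\<close>

definition trail :: "'i set \<Rightarrow> ('i \<Rightarrow> 'a \<times> 'a) \<Rightarrow> 'a \<Rightarrow> ('i \<times> 'a) list \<Rightarrow> bool" where
  "trail I e v s \<longleftrightarrow> walk e v s \<and> distinct (map fst s) \<and> fst ` set s \<subseteq> I"

lemma map_fst_walk_steps: "map fst (walk_steps v s) = map fst s"
  by (induction v s rule: walk_steps.induct) auto

lemma walk_end_Nil [simp]: "walk_end v [] = v"
  and walk_end_snoc [simp]: "walk_end v (s @ [(i, w)]) = w"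
  and walk_end_Cons [simp]: "walk_end v ((i, w) # s) = walk_end w s"
  by (auto simp: walk_end_def)

lemma walk_end_in: "walk_end v s \<in> insert v (snd ` set s)"
proof -
  have "last (v # map snd s) \<in> set (v # map snd s)" by (rule last_in_set) simp
  then show ?thesis by (simp add: walk_end_def)
qed

lemma walk_steps_append:
  "walk_steps v (s @ s') = walk_steps v s @ walk_steps (walk_end v s) s'"
  by (induction v s rule: walk_steps.induct) auto

lemma walk_append: "walk e v (s @ s') \<longleftrightarrow> walk e v s \<and> walk e (walk_end v s) s'"
  by (simp add: walk_def walk_steps_append ball_Un)

lemma trail_Nil [simp]: "trail I e v []"
  by (simp add: trail_def walk_def)

lemma trail_append:
  "trail I e v (s @ s') \<longleftrightarrow> trail I e v s \<and> trail I e (walk_end v s) s' \<and>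
     fst ` set s \<inter> fst ` set s' = {}"
  by (auto simp: trail_def walk_append)

lemma trail_snoc:
  "trail I e v (s @ [(i, w)]) \<longleftrightarrow>
     trail I e v s \<and> i \<in> I \<and> i \<notin> fst ` set s \<and> joins (e i) (walk_end v s) w"
  by (auto simp: trail_append) (auto simp: trail_def walk_def)

text \<open>Both ends of a used edge are consecutive vertices of the trail. The contrapositive is
  what matters later: an edge with an unvisited end has not been used.\<close>

lemma trail_vertex_visited:
  assumes "trail I e v s" "i \<in> fst ` set s" "joins (e i) a b"
  shows "a \<in> insert v (snd ` set s)"
proof -
  from assms(2) obtain x s1 s2 where s: "s = (s1 @ [(i, x)]) @ s2"
    by (auto dest!: split_list)
  with assms(1) have "joins (e i) (walk_end v s1) x"
    by (metis trail_append trail_snoc)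
  with assms(3) have "a = x \<or> a = walk_end v s1" by (auto simp: joins_def)
  with walk_end_in[of v s1] show ?thesis by (auto simp: s)
qed

text \<open>If \<open>i\<close> is new, append it; if it has been used, cut the trail right after
  that use.\<close>

lemma trail_through_index:
  assumes "trail I e v s" "i \<in> I" "joins (e i) (walk_end v s) b"
  shows "\<exists>s' w. trail I e v (s' @ [(i, w)])"
proof (cases "i \<in> fst ` set s")
  case True
  then obtain x s1 s2 where s: "s = (s1 @ [(i, x)]) @ s2"
    by (auto dest!: split_list)
  with assms(1) have "trail I e v (s1 @ [(i, x)])" by (metis trail_append)
  then show ?thesis by blast
next
  case False
  with assms show ?thesis by (auto simp: trail_snoc intro!: exI[of _ s] exI[of _ b])
qed

lemma trail_to_reachable:
  assumes "(v, a) \<in> {(a, b). \<exists>i\<in>I. joins (e i) a b}\<^sup>*"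
  shows "\<exists>s. trail I e v s \<and> walk_end v s = a"
  using assms
proof (induction rule: rtrancl_induct)
  case base
  then show ?case by (auto intro: exI[of _ "[]"])
next
  case (step a b)
  then obtain s i where s: "trail I e v s" "walk_end v s = a" and i: "i \<in> I" "joins (e i) a b"
    by auto
  then obtain s' w where s': "trail I e v (s' @ [(i, w)])"
    using trail_through_index by metis
  then have "trail I e v s'" "joins (e i) (walk_end v s') w" by (simp_all add: trail_snoc)
  \<comment> \<open>The trail may cross edge \<open>i\<close> from \<open>b\<close> to
    \<open>a\<close>; in that case dropping its last step leaves a trail that ends in
    \<open>b\<close>.\<close>
  with i have "w = b \<or> walk_end v s' = b" by (auto simp: joins_def)
  then show ?case using s' \<open>trail I e v s'\<close> by (metis walk_end_snoc)
qed

lemma trail_end_reachable: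
  assumes "trail I e v s"
  shows "(v, walk_end v s) \<in> {(a, b). \<exists>i\<in>I. joins (e i) a b}\<^sup>*"
  using assms
proof (induction s rule: rev_induct)
  case (snoc x s)
  obtain i w where "x = (i, w)" by force
  with snoc show ?case by (auto simp: trail_snoc intro: rtrancl_into_rtrancl)
qed auto

text \<open>Follow the first trail and then the second one backwards, up to the first repeated vertex.\<close>

lemma revisiting_trail_if_two_trails:
  assumes "trail I e v S" "trail I e v (Q @ [(j, walk_end v S)])" "j \<notin> fst ` set S"
  shows "\<exists>s. trail I e v s \<and> \<not> distinct (v # map snd s)"
  using assms
proof (induction Q arbitrary: S j rule: rev_induct)
  case Nil
  then have "trail I e v (S @ [(j, v)])"
    by (simp add: trail_snoc trail_snoc[where s = "[]", simplified] joins_commute)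
  then show ?case by (auto intro!: exI[of _ "S @ [(j, v)]"])
next
  case (snoc x Q)
  obtain i u where x: "x = (i, u)" by force
  note Q = snoc.prems(2)[unfolded x trail_snoc walk_end_snoc]
  have tr: "trail I e v (S @ [(j, u)])"
    unfolding trail_snoc using Q snoc.prems(1,3) by (simp add: joins_commute)
  have trQ: "trail I e v (Q @ [(i, u)])" and "i \<noteq> j"
    unfolding trail_snoc using Q by auto
  show ?case
  proof (cases "u \<in> insert v (snd ` set S)")
    case True
    with tr show ?thesis by (intro exI[of _ "S @ [(j, u)]"]) auto
  next
    case False
    \<comment> \<open>An index used by \<open>S\<close> would make its end \<open>u\<close> a
      visited vertex. So \<open>i\<close> is still available, and the induction continues with
      \<open>S\<close> prolonged to \<open>u\<close> and with the shorter \<open>Q\<close>.\<close>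
    with trQ snoc.prems(1) have "i \<notin> fst ` set S"
      by (metis trail_vertex_visited trail_snoc joins_commute)
    then show ?thesis using snoc.IH[OF tr, of i] trQ \<open>i \<noteq> j\<close> by simp
  qed
qed

text \<open>Give each edge index \<open>i\<close> of the component a trail whose last step uses
  \<open>i\<close>, and let \<open>w i\<close> be the end of that trail. Two indices with the same
  end would yield two trails as in the previous lemma, hence a revisit, so \<open>w\<close> is
  injective. No trail returns to \<open>v\<close>, so \<open>w\<close> misses the vertex
  \<open>v\<close> of \<open>C\<close>.\<close>

lemma card_edges_less_if_no_revisiting_trail:
  fixes e :: "'i \<Rightarrow> 'a \<times> 'a"
  defines "R \<equiv> \<lambda>I. {(a, b). \<exists>i\<in>I. joins (e i) a b}"
  assumes simple: "\<And>s. trail I e v s \<Longrightarrow> distinct (v # map snd s)"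
    and C: "C = {w. (v, w) \<in> (R I)\<^sup>*}" and fin: "finite C"
  shows "card {i \<in> I. fst (e i) \<in> C \<and> snd (e i) \<in> C} < card C"
proof -
  define T where "T = {i \<in> I. fst (e i) \<in> C \<and> snd (e i) \<in> C}"
  have "\<forall>i\<in>T. \<exists>s w. trail I e v (s @ [(i, w)])"
  proof
    fix i assume i: "i \<in> T"
    then have "(v, fst (e i)) \<in> {(a, b). \<exists>i\<in>I. joins (e i) a b}\<^sup>*"
      by (simp add: T_def C R_def)
    from trail_to_reachable[OF this] obtain s
      where "trail I e v s" "walk_end v s = fst (e i)" by blast
    then show "\<exists>s w. trail I e v (s @ [(i, w)])"
      using i by (intro trail_through_index[where b = "snd (e i)"]) (auto simp: T_def joins_def)
  qed
  then obtain s w where sw: "trail I e v (s i @ [(i, w i)])" if "i \<in> T" for i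
    unfolding bchoice_iff by blast
  have "inj_on w T"
  proof (rule inj_onI, rule ccontr)
    fix i j assume i: "i \<in> T" and j: "j \<in> T" and eq: "w i = w j" and "i \<noteq> j"
    \<comment> \<open>If the trail \<open>s i\<close> had used \<open>j\<close>, it would already
      have visited \<open>w j\<close>, which equals \<open>w i\<close>, and its last step would be a
      revisit.\<close>
    have "j \<notin> fst ` set (s i)"
    proof
      assume "j \<in> fst ` set (s i)"
      then have "w i \<in> insert v (snd ` set (s i))"
        using sw[OF i] sw[OF j] eq by (metis trail_vertex_visited trail_snoc joins_commute)
      with simple[OF sw[OF i]] show False by auto
    qed
    with \<open>i \<noteq> j\<close> have "j \<notin> fst ` set (s i @ [(i, w i)])" by auto
    with revisiting_trail_if_two_trails[OF sw[OF i], of "s j" j] sw[OF j] eq simple show False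
      by auto
  qed
  moreover have "w ` T \<subseteq> C - {v}"
  proof
    fix x assume "x \<in> w ` T"
    then obtain i where i: "i \<in> T" "x = w i" by auto
    then show "x \<in> C - {v}"
      using trail_end_reachable[OF sw[OF i(1)]] simple[OF sw[OF i(1)]] by (auto simp: C R_def)
  qed
  ultimately have "card T \<le> card (C - {v})"
    using fin by (metis card_inj_on_le finite_Diff)
  also have "\<dots> < card C" using fin by (intro psubset_card_mono) (auto simp: C)
  finally show ?thesis by (simp add: T_def)
qed

text \<open>Truncating at a revisit pays off in the count: the last vertex then ranges over the
  vertices visited so far instead of all \<open>n\<close> vertices.\<close>

lemma first_revisit:
  assumes "trail I e v s" "\<not> distinct (v # map snd s)"
  shows "\<exists>s' i w. trail I e v (s' @ [(i, w)]) \<and> w \<in> insert v (snd ` set s')"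
  using assms
proof (induction s rule: rev_induct)
  case (snoc x s)
  obtain i w where x: "x = (i, w)" by force
  show ?case
  proof (cases "distinct (v # map snd s)")
    case True
    with snoc.prems show ?thesis by (intro exI[of _ s] exI[of _ i] exI[of _ w]) (auto simp: x)
  next
    case False
    with snoc show ?thesis by (auto simp: x trail_snoc)
  qed
qed simp

lemma trail_vertices:
  assumes "trail I e v s"
  shows "snd ` set s \<subseteq> (\<Union>i\<in>I. {fst (e i), snd (e i)})"
  using assms
proof (induction s rule: rev_induct)
  case (snoc x s)
  obtain i w where "x = (i, w)" by force
  with snoc show ?case by (force simp: trail_snoc joins_def)
qed simp

section \<open>Frozen vertices\<close>

text \<open>A step adds the selected edge or nothing, whatever the freezing rule and the coin
  decide; \<open>I\<close> is the set of times at which the edge was kept. Working with times keeps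
  parallel edges apart.\<close>

lemma frozen_process_eq_image_mset:
  "\<exists>I \<subseteq> {..<m}. frozen_process m \<omega> = image_mset (fst \<circ> \<omega>) (mset_set I)"
proof (induction m)
  case (Suc m)
  then obtain I where I: "I \<subseteq> {..<m}" "frozen_process m \<omega> = image_mset (fst \<circ> \<omega>) (mset_set I)"
    by blast
  obtain u v k where uvk: "\<omega> m = ((u, v), k)" by (metis surj_pair)
  from I have "finite I" "m \<notin> I" by (auto intro: finite_subset)
  then have "add_mset (u, v) (frozen_process m \<omega>) = image_mset (fst \<circ> \<omega>) (mset_set (insert m I))"
    by (simp add: I uvk)
  moreover have "insert m I \<subseteq> {..<Suc m}" "I \<subseteq> {..<Suc m}" using I by auto
  moreover have "frozen_process (Suc m) \<omega> = frozen_process m \<omega> \<or>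
      frozen_process (Suc m) \<omega> = add_mset (u, v) (frozen_process m \<omega>)"
    by (simp add: uvk)
  ultimately show ?case using I(2) by metis
qed simp

lemma frozen_imp_revisiting_trail:
  assumes "finite I" "frozen (image_mset e (mset_set I)) v"
  shows "\<exists>s. trail I e v s \<and> \<not> distinct (v # map snd s)"
proof (rule ccontr)
  assume *: "\<not> ?thesis"
  let ?M = "image_mset e (mset_set I)"
  define C where "C = component ?M v"
  have "adjacency ?M = {(a, b). \<exists>i\<in>I. joins (e i) a b}"
    using assms(1) by (auto simp: adjacency_def joins_def image_iff eq_commute)
  then have C: "C = {w. (v, w) \<in> {(a, b). \<exists>i\<in>I. joins (e i) a b}\<^sup>*}"
    by (simp add: C_def component_def)
  \<comment> \<open>Finiteness must be secured, since an infinite component would have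
    \<open>card\<close> equal to 0. Every vertex of \<open>C\<close> other than \<open>v\<close> is
    an end of one of the finitely many edges.\<close>
  have "w \<in> insert v (\<Union>i\<in>I. {fst (e i), snd (e i)})" if "w \<in> C" for w
    using that unfolding C mem_Collect_eq
    by (cases rule: rtranclE) (auto simp: joins_def, (metis fst_conv snd_conv)+)
  then have "C \<subseteq> insert v (\<Union>i\<in>I. {fst (e i), snd (e i)})" by blast
  then have fin: "finite C" by (rule finite_subset) (use assms(1) in auto)
  have "card {i \<in> I. fst (e i) \<in> C \<and> snd (e i) \<in> C} < card C"
    using card_edges_less_if_no_revisiting_trail[OF _ C fin] * by blast
  moreover have "size (edges_within ?M C) = card {i \<in> I. fst (e i) \<in> C \<and> snd (e i) \<in> C}"
    using assms(1) by (simp add: edges_within_def filter_mset_image_mset filter_mset_mset_set)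
  ultimately show False
    using assms(2) by (simp add: frozen_def is_unicycle_def C_def)
qed

section \<open>Counting the trails that close up\<close>

lemma trail_mono: "trail I e v s \<Longrightarrow> I \<subseteq> J \<Longrightarrow> trail J e v s"
  by (auto simp: trail_def)

lemma trail_length_le:
  assumes "trail I e v s" "finite I"
  shows "length s \<le> card I"
  using assms by (metis trail_def card_mono distinct_card length_map set_map)

text \<open>Here \<open>k\<close> counts the free steps, each with \<open>m * n\<close> choices. The
  closing step has \<open>m\<close> choices of a time and at most \<open>Suc k\<close> choices of a
  vertex, so these lists have length \<open>Suc k\<close>. They need not be trails; that condition
  becomes the random event.\<close>

definition lassos :: "nat \<Rightarrow> nat \<Rightarrow> nat \<Rightarrow> nat \<Rightarrow> (nat \<times> nat) list set" where
  "lassos m n v k = (\<lambda>(s, x). s @ [x]) `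
     (SIGMA s:{s. set s \<subseteq> {..<m} \<times> {1..n} \<and> length s = k}. {..<m} \<times> insert v (snd ` set s))"

lemma finite_lassos [simp]: "finite (lassos m n v k)"
  unfolding lassos_def by (intro finite_imageI finite_SigmaI finite_lists_length_eq) auto

lemma length_lassos: "l \<in> lassos m n v k \<Longrightarrow> length l = Suc k"
  by (auto simp: lassos_def)

lemma card_lassos_le: "card (lassos m n v k) \<le> (m * n) ^ k * (m * Suc k)"
proof -
  let ?S = "{s. set s \<subseteq> {..<m} \<times> {1..n} \<and> length s = k}"
  let ?X = "\<lambda>s::(nat \<times> nat) list. {..<m} \<times> insert v (snd ` set s)"
  have fin: "finite ?S" by (intro finite_lists_length_eq) auto
  have card: "card (insert v (snd ` set s)) \<le> Suc (length s)" for s :: "(nat \<times> nat) list"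
    by (metis card_length length_Cons length_map list.simps(15) set_map)
  have "card (lassos m n v k) \<le> card (Sigma ?S ?X)"
    unfolding lassos_def using fin by (intro card_image_le finite_SigmaI) auto
  also have "\<dots> = (\<Sum>s\<in>?S. card (?X s))"
    using fin by (intro card_SigmaI) auto
  also have "\<dots> \<le> (\<Sum>s\<in>?S. m * Suc k)"
  proof (intro sum_mono)
    fix s assume "s \<in> ?S"
    then show "card (?X s) \<le> m * Suc k"
      using card[of s] by (simp add: card_cartesian_product del: mult_Suc_right)
  qed
  also have "\<dots> = (m * n) ^ k * (m * Suc k)"
    by (simp add: card_lists_length_eq card_cartesian_product)
  finally show ?thesis .
qed

lemma frozen_imp_lasso:
  assumes edges: "\<forall>i<m. fst (\<omega> i) \<in> possible_edges n"
    and "frozen (frozen_process m \<omega>) v"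
  shows "\<exists>k<m. \<exists>l\<in>lassos m n v k. trail {..<m} (fst \<circ> \<omega>) v l"
proof -
  obtain I where I: "I \<subseteq> {..<m}" "frozen_process m \<omega> = image_mset (fst \<circ> \<omega>) (mset_set I)"
    using frozen_process_eq_image_mset by blast
  have "finite I" using I(1) finite_subset by blast
  then obtain s' where s': "trail I (fst \<circ> \<omega>) v s'" "\<not> distinct (v # map snd s')"
    using frozen_imp_revisiting_trail assms(2) I(2) by metis
  obtain s i w where s: "trail I (fst \<circ> \<omega>) v (s @ [(i, w)])" and w: "w \<in> insert v (snd ` set s)"
    using first_revisit[OF s'] by blast
  note tr = trail_mono[OF s I(1)]
  then have trs: "trail {..<m} (fst \<circ> \<omega>) v s" and "i < m" by (simp_all add: trail_snoc)
  have "snd ` set s \<subseteq> (\<Union>i<m. {fst (fst (\<omega> i)), snd (fst (\<omega> i))})"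
    using trail_vertices[OF trs] by simp
  also have "\<dots> \<subseteq> {1..n}"
    using edges by (auto simp: possible_edges_def case_prod_unfold)
  finally have "snd ` set s \<subseteq> {1..n}" .
  moreover have "fst ` set s \<subseteq> {..<m}" using trs by (simp add: trail_def)
  ultimately have "set s \<subseteq> {..<m} \<times> {1..n}" by (auto simp: image_subset_iff)
  then have "s @ [(i, w)] \<in> lassos m n v (length s)"
    using w \<open>i < m\<close> unfolding lassos_def by (intro image_eqI[of _ _ "(s, (i, w))"]) auto
  \<comment> \<open>The closing step makes the difference: the whole trail has
    \<open>Suc (length s)\<close> steps at distinct times below \<open>m\<close>.\<close>
  moreover have "length s < m" using trail_length_le[OF tr] by simp
  ultimately show ?thesis using tr by blast
qed

section \<open>Probabilities\<close>

lemma finite_possible_edges: "finite (possible_edges n)"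
  by (rule finite_subset[of _ "{1..n} \<times> {1..n}"]) (auto simp: possible_edges_def)

lemma card_possible_edges: "2 * card (possible_edges n) = n * (n - 1)"
proof (induction n)
  case 0
  have "possible_edges 0 = {}" by (auto simp: possible_edges_def)
  then show ?case by simp
next
  case (Suc n)
  have "possible_edges (Suc n) = possible_edges n \<union> {1..n} \<times> {Suc n}"
    by (auto simp: possible_edges_def)
  moreover have "card (possible_edges n \<union> {1..n} \<times> {Suc n}) = card (possible_edges n) + n"
    by (subst card_Un_disjoint)
      (auto simp: finite_possible_edges card_cartesian_product, auto simp: possible_edges_def)
  ultimately show ?case using Suc by (cases n) (auto simp: algebra_simps)
qed

lemma possible_edges_nonempty: "2 \<le> n \<Longrightarrow> possible_edges n \<noteq> {}"
  using card_possible_edges[of n] by auto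

lemma prob_joins_le:
  assumes "2 \<le> n"
  shows "measure (measure_pmf (pair_pmf (pmf_of_set (possible_edges n)) (bernoulli_pmf p)))
           {x. joins (fst x) a b} \<le> 2 / (real n * (real n - 1))"
proof -
  let ?E = "possible_edges n"
  have card: "2 * real (card ?E) = real n * (real n - 1)"
    using arg_cong[OF card_possible_edges[of n], of real] assms by (simp add: of_nat_diff)
  have "{x. joins (fst x) a b} = fst -` {e. joins e a b}" by auto
  then have "measure (measure_pmf (pair_pmf (pmf_of_set ?E) (bernoulli_pmf p))) {x. joins (fst x) a b}
      = measure (measure_pmf (map_pmf fst (pair_pmf (pmf_of_set ?E) (bernoulli_pmf p)))) {e. joins e a b}"
    by (simp add: measure_map_pmf)
  also have "\<dots> = real (card (?E \<inter> {e. joins e a b})) / real (card ?E)"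
    using possible_edges_nonempty[OF assms] finite_possible_edges by (simp add: map_fst_pair_pmf measure_pmf_of_set)
  also have "\<dots> \<le> 1 / real (card ?E)"
  proof -
    \<comment> \<open>An unordered pair has only one representative in increasing order.\<close>
    have "?E \<inter> {e. joins e a b} \<subseteq> {(min a b, max a b)}"
      by (auto simp: possible_edges_def joins_def min_def max_def)
    from card_mono[OF _ this] have "card (?E \<inter> {e. joins e a b}) \<le> 1" by simp
    then show ?thesis by (intro divide_right_mono) auto
  qed
  also have "\<dots> = 2 / (real n * (real n - 1))" by (simp flip: card)
  finally show ?thesis .
qed

section \<open>Trail events in the product space\<close>

interpretation frozen_space: product_prob_space
  "\<lambda>_::nat. measure_pmf (pair_pmf (pmf_of_set (possible_edges n)) (bernoulli_pmf p))" UNIV for n p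
  by unfold_locales

lemma prob_space_frozen_space: "prob_space (frozen_space p n)"
  unfolding frozen_space_def by (rule frozen_space.prob_space_axioms)

lemma space_frozen_space [simp]: "space (frozen_space p n) = UNIV"
  by (simp add: frozen_space_def space_PiM)

lemma measurable_coordinate [measurable]:
  "(\<lambda>\<omega>. \<omega> i) \<in> frozen_space p n \<rightarrow>\<^sub>M count_space UNIV"
proof -
  have "(\<lambda>\<omega>. \<omega> i) \<in> frozen_space p n \<rightarrow>\<^sub>M
      measure_pmf (pair_pmf (pmf_of_set (possible_edges n)) (bernoulli_pmf p))"
    unfolding frozen_space_def by (rule measurable_component_singleton) simp
  then show ?thesis by (simp add: measurable_def)
qed

lemma trail_events [measurable]: "{\<omega>. trail I (fst \<circ> \<omega>) v l} \<in> sets (frozen_space p n)"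
proof -
  have "{\<omega> \<in> space (frozen_space p n). joins (fst (\<omega> i)) a b} \<in> sets (frozen_space p n)" for i a b
    using measurable_sets[OF measurable_coordinate, of "{x. joins (fst x) a b}" i p n]
    by (simp add: vimage_def)
  then have "{\<omega> \<in> space (frozen_space p n). \<forall>(i, a, b) \<in> set (walk_steps v l). joins (fst (\<omega> i)) a b}
      \<in> sets (frozen_space p n)"
    unfolding case_prod_unfold by (intro sets.sets_Collect_finite_All) auto
  \<comment> \<open>The conditions on the indices do not involve the random input: either they fail
    and the event is empty, or only the walk condition remains.\<close>
  then show ?thesis
    unfolding trail_def walk_def comp_def
    by (cases "distinct (map fst l) \<and> fst ` set l \<subseteq> I") (simp_all only: space_frozen_space simp_thms, simp_all)
qed

text \<open>Distinct indices mean independent coordinates, so the event lies in a cylinder over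
  \<open>length l\<close> coordinates whose probability factorises. A list with a repeated index
  gives the empty event.\<close>

lemma prob_trail_le:
  assumes "2 \<le> n"
  shows "measure (frozen_space p n) {\<omega>. trail I (fst \<circ> \<omega>) v l}
           \<le> (2 / (real n * (real n - 1))) ^ length l"
proof (cases "distinct (map fst l)")
  case False
  then show ?thesis using assms by (simp add: trail_def)
next
  case True
  let ?D = "measure_pmf (pair_pmf (pmf_of_set (possible_edges n)) (bernoulli_pmf p))"
  define J where "J = fst ` set l"
  \<comment> \<open>\<open>X i\<close> gathers the demands of all steps with index \<open>i\<close>,
    which avoids looking up the step that belongs to \<open>i\<close>.\<close>
  define X where
    "X = (\<lambda>i. {x :: edge \<times> bool. \<forall>(j, a, b) \<in> set (walk_steps v l). j = i \<longrightarrow> joins (fst x) a b})"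
  have "measure (frozen_space p n) {\<omega>. trail I (fst \<circ> \<omega>) v l}
      \<le> measure (frozen_space p n) (prod_emb UNIV (\<lambda>_. ?D) J (Pi\<^sub>E J X))"
  proof (intro finite_measure.finite_measure_mono)
    show "finite_measure (frozen_space p n)"
      using prob_space_frozen_space by (rule prob_space.finite_measure)
    show "{\<omega>. trail I (fst \<circ> \<omega>) v l} \<subseteq> prod_emb UNIV (\<lambda>_. ?D) J (Pi\<^sub>E J X)"
      by (auto simp: prod_emb_def X_def trail_def walk_def)
    show "prod_emb UNIV (\<lambda>_. ?D) J (Pi\<^sub>E J X) \<in> sets (frozen_space p n)"
      unfolding frozen_space_def J_def by (intro sets_PiM_I) auto
  qed
  also have "\<dots> = (\<Prod>i\<in>J. measure ?D (X i))"
    unfolding frozen_space_def J_def by (intro frozen_space.measure_PiM_emb) auto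
  also have "\<dots> \<le> (\<Prod>i\<in>J. 2 / (real n * (real n - 1)))"
  proof (intro prod_mono conjI measure_nonneg)
    fix i assume "i \<in> J"
    then have "i \<in> set (map fst (walk_steps v l))" by (simp add: map_fst_walk_steps J_def)
    then obtain a b where "(i, a, b) \<in> set (walk_steps v l)" by auto
    then have "X i \<subseteq> {x. joins (fst x) a b}" by (auto simp: X_def)
    then have "measure ?D (X i) \<le> measure ?D {x. joins (fst x) a b}"
      by (intro measure_pmf.finite_measure_mono) auto
    also note prob_joins_le[OF assms]
    finally show "measure ?D (X i) \<le> 2 / (real n * (real n - 1))" .
  qed
  also have "\<dots> = (2 / (real n * (real n - 1))) ^ length l"
    using distinct_card[OF True] by (simp add: J_def)
  finally show ?thesis .
qed

section \<open>Measurability of the process\<close>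

instance multiset :: (countable) countable
proof (rule countable_classI)
  fix M N :: "'a multiset"
  assume "to_nat (SOME xs. mset xs = M) = to_nat (SOME xs. mset xs = N)"
  then show "M = N" by (metis (mono_tags) ex_mset from_nat_to_nat someI_ex)
qed

text \<open>The state at time \<open>m\<close> takes values in a countable type, so it suffices to
  treat each fixed state; the next state is then a function of the single coordinate
  \<open>m\<close>.\<close>

lemma measurable_frozen_process [measurable]:
  "frozen_process m \<in> frozen_space p n \<rightarrow>\<^sub>M count_space UNIV"
proof (induction m)
  case (Suc m)
  have "(\<lambda>\<omega>. frozen_step (frozen_process m \<omega>) (\<omega> m)) \<in> frozen_space p n \<rightarrow>\<^sub>M count_space UNIV"
    by (rule measurable_compose_countable[OF _ Suc])
       (rule measurable_compose[OF measurable_coordinate], simp)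
  then show ?case by simp
qed simp

lemma measurable_num_frozen [measurable]:
  "num_frozen n m \<in> frozen_space p n' \<rightarrow>\<^sub>M count_space UNIV"
  unfolding num_frozen_def[abs_def]
  by (rule measurable_compose[OF measurable_frozen_process]) simp

lemma frozen_events [measurable]: "{\<omega>. frozen (frozen_process m \<omega>) v} \<in> sets (frozen_space p n)"
proof -
  have "{\<omega> \<in> space (frozen_space p n). frozen (frozen_process m \<omega>) v} \<in> sets (frozen_space p n)"
    by measurable
  then show ?thesis by simp
qed

text \<open>The sample space consists of all sequences of pairs, impossible edges included. This
  restricts the vertices of a lasso to \<open>{1..n}\<close> almost surely.\<close>

lemma AE_possible_edges:
  assumes "2 \<le> n"
  shows "AE \<omega> in frozen_space p n. \<forall>i<m. fst (\<omega> i) \<in> possible_edges n"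
proof -
  have "AE x in measure_pmf (pair_pmf (pmf_of_set (possible_edges n)) (bernoulli_pmf p)).
      fst x \<in> possible_edges n"
    using possible_edges_nonempty[OF assms] by (auto simp: AE_measure_pmf_iff finite_possible_edges)
  then have "AE \<omega> in frozen_space p n. fst (\<omega> i) \<in> possible_edges n" for i
    unfolding frozen_space_def
    by (intro AE_PiM_component[where P = "\<lambda>x. fst x \<in> possible_edges n"] prob_space_measure_pmf) auto
  then show ?thesis by (simp add: AE_all_countable)
qed

text \<open>This is a union bound over lassos. The factor \<open>real n\<close>, which stands for
  the choice of \<open>v\<close>, supplies the power of \<open>n\<close> that the closing step
  lacks, so \<open>n\<close>, \<open>m\<close> and \<open>?q\<close> all occur to the power
  \<open>Suc k\<close>, and \<open>n * m * ?q\<close> is \<open>2 * m / (n - 1)\<close>.\<close>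

lemma prob_frozen_le:
  assumes "2 \<le> n"
  shows "real n * measure (frozen_space p n) {\<omega>. frozen (frozen_process m \<omega>) v}
           \<le> (\<Sum>k<m. real (Suc k) * (2 * real m / (real n - 1)) ^ Suc k)"
proof -
  interpret P: prob_space "frozen_space p n" by (rule prob_space_frozen_space)
  let ?q = "2 / (real n * (real n - 1))"
  let ?A = "\<lambda>l. {\<omega>. trail {..<m} (fst \<circ> \<omega>) v l}"
  have "P.prob {\<omega>. frozen (frozen_process m \<omega>) v} \<le> P.prob (\<Union>k<m. \<Union>l\<in>lassos m n v k. ?A l)"
  proof (rule P.finite_measure_mono_AE)
    show "AE \<omega> in frozen_space p n. \<omega> \<in> {\<omega>. frozen (frozen_process m \<omega>) v} \<longrightarrow>
        \<omega> \<in> (\<Union>k<m. \<Union>l\<in>lassos m n v k. ?A l)"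
      using AE_possible_edges[OF assms, where p = p and m = m]
    proof eventually_elim
      case (elim \<omega>)
      from frozen_imp_lasso[OF this] show ?case by blast
    qed
    show "(\<Union>k<m. \<Union>l\<in>lassos m n v k. ?A l) \<in> P.events"
      by (intro sets.finite_UN) (auto simp: trail_events)
  qed
  also have "\<dots> \<le> (\<Sum>k<m. P.prob (\<Union>l\<in>lassos m n v k. ?A l))"
    by (intro P.finite_measure_subadditive_finite) (auto intro!: sets.finite_UN simp: trail_events)
  also have "\<dots> \<le> (\<Sum>k<m. real (card (lassos m n v k)) * ?q ^ Suc k)"
  proof (intro sum_mono)
    fix k
    have "P.prob (\<Union>l\<in>lassos m n v k. ?A l) \<le> (\<Sum>l\<in>lassos m n v k. P.prob (?A l))"
      by (intro P.finite_measure_subadditive_finite) (auto simp: trail_events)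
    also have "\<dots> \<le> (\<Sum>l\<in>lassos m n v k. ?q ^ Suc k)"
      using prob_trail_le[OF assms] by (intro sum_mono) (metis length_lassos)
    finally show "P.prob (\<Union>l\<in>lassos m n v k. ?A l) \<le> real (card (lassos m n v k)) * ?q ^ Suc k"
      by simp
  qed
  also have "\<dots> \<le> (\<Sum>k<m. real ((m * n) ^ k * (m * Suc k)) * ?q ^ Suc k)"
    using assms by (intro sum_mono mult_right_mono of_nat_mono card_lassos_le) auto
  finally have "real n * P.prob {\<omega>. frozen (frozen_process m \<omega>) v}
      \<le> real n * (\<Sum>k<m. real ((m * n) ^ k * (m * Suc k)) * ?q ^ Suc k)"
    by (rule mult_left_mono) simp
  also have "\<dots> = (\<Sum>k<m. real (Suc k) * (2 * real m / (real n - 1)) ^ Suc k)"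
    unfolding sum_distrib_left
  proof (intro sum.cong refl)
    fix k
    have distrib: "x * ((y * x) ^ k * (y * z) * q ^ Suc k) = z * (x * y * q) ^ Suc k"
      for x y z q :: real
      by (simp add: power_mult_distrib)
    have "real n * (real ((m * n) ^ k * (m * Suc k)) * ?q ^ Suc k)
        = real (Suc k) * (real n * real m * ?q) ^ Suc k"
      unfolding of_nat_mult of_nat_power by (rule distrib)
    also have "real n * real m * ?q = 2 * real m / (real n - 1)" using assms by simp
    finally show "real n * (real ((m * n) ^ k * (m * Suc k)) * ?q ^ Suc k)
        = real (Suc k) * (2 * real m / (real n - 1)) ^ Suc k" .
  qed
  finally show ?thesis .
qed

section \<open>The expected number of frozen vertices\<close>

lemma num_frozen_le: "num_frozen n m \<omega> \<le> n"
  unfolding num_frozen_def by (rule order.trans[OF card_mono[of "{1..n}"]]) auto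

lemma integrable_num_frozen: "integrable (frozen_space p n) (\<lambda>\<omega>. real (num_frozen n m \<omega>))"
proof -
  interpret P: prob_space "frozen_space p n" by (rule prob_space_frozen_space)
  show ?thesis
    by (rule P.integrable_const_bound[of _ "real n"]) (auto simp: num_frozen_le)
qed

lemma expectation_num_frozen_le:
  assumes "2 \<le> n"
  shows "(\<integral>\<omega>. real (num_frozen n m \<omega>) \<partial>frozen_space p n)
           \<le> (\<Sum>k<m. real (Suc k) * (2 * real m / (real n - 1)) ^ Suc k)" (is "_ \<le> ?S")
proof -
  interpret P: prob_space "frozen_space p n" by (rule prob_space_frozen_space)
  let ?F = "\<lambda>v. {\<omega>. frozen (frozen_process m \<omega>) v}"
  have "real (num_frozen n m \<omega>) = (\<Sum>v\<in>{1..n}. indicator (?F v) \<omega>)" for \<omega>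
    by (simp add: num_frozen_def indicator_def) (rule arg_cong[of _ _ card], auto)
  then have "(\<integral>\<omega>. real (num_frozen n m \<omega>) \<partial>frozen_space p n) = (\<Sum>v\<in>{1..n}. P.prob (?F v))"
    by (simp add: frozen_events Bochner_Integration.integral_sum P.emeasure_eq_measure)
  also have "\<dots> \<le> (\<Sum>v\<in>{1..n}. ?S / real n)"
  proof (intro sum_mono)
    fix v
    show "P.prob (?F v) \<le> ?S / real n"
      using assms by (intro mult_imp_le_div_pos) (simp, subst mult.commute, rule prob_frozen_le)
  qed
  also have "\<dots> = ?S" using assms by simp
  finally show ?thesis .
qed

lemma expectation_num_frozen_bounded:
  assumes "0 \<le> t" "t < 1 / 2"
  shows "\<exists>B>0. \<forall>n\<ge>2. (\<integral>\<omega>. real (num_frozen n (nat \<lfloor>real n * t\<rfloor>) \<omega>) \<partial>frozen_space p n) \<le> B"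
proof -
  \<comment> \<open>\<open>r\<close> is the midpoint of \<open>2 * t\<close> and 1: a ratio below 1
    that leaves room for replacing \<open>n\<close> by \<open>n - 1\<close>.\<close>
  define r where "r = t + 1 / 2"
  have r: "0 < r" "r < 1" "0 < r - 2 * t" using assms by (auto simp: r_def)
  \<comment> \<open>The first summand covers small \<open>n\<close>, where the trivial bound by
    \<open>n\<close> suffices; the second is the sum of the differentiated geometric series and
    covers large \<open>n\<close>.\<close>
  define B where "B = r / (r - 2 * t) + 1 / (1 - r)\<^sup>2"
  have sums: "(\<lambda>k. real (Suc k) * r ^ k) sums (1 / (1 - r)\<^sup>2)"
    using geometric_deriv_sums[of r] r by simp
  have "(\<integral>\<omega>. real (num_frozen n (nat \<lfloor>real n * t\<rfloor>) \<omega>) \<partial>frozen_space p n) \<le> B" if n: "2 \<le> n" for n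
  proof (cases "real n * (r - 2 * t) \<le> r")
    case True
    interpret P: prob_space "frozen_space p n" by (rule prob_space_frozen_space)
    have "(\<integral>\<omega>. real (num_frozen n (nat \<lfloor>real n * t\<rfloor>) \<omega>) \<partial>frozen_space p n)
        \<le> (\<integral>\<omega>. real n \<partial>frozen_space p n)"
      by (intro integral_mono integrable_num_frozen) (auto simp: num_frozen_le)
    also have "\<dots> = real n" by (simp add: P.prob_space[simplified])
    also have "\<dots> \<le> r / (r - 2 * t)" using True r by (simp add: field_simps)
    also have "\<dots> \<le> B" by (simp add: B_def)
    finally show ?thesis .
  next
    case False
    define m where "m = nat \<lfloor>real n * t\<rfloor>"
    have "real m \<le> real n * t" using assms by (simp add: m_def)
    \<comment> \<open>The case assumption rearranges to
      \<open>2 * n * t < r * (n - 1)\<close>.\<close>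
    then have "2 * real m \<le> r * (real n - 1)" using False by (simp add: algebra_simps)
    then have q: "2 * real m / (real n - 1) \<le> r" using n by (simp add: field_simps)
    have "(\<integral>\<omega>. real (num_frozen n m \<omega>) \<partial>frozen_space p n)
        \<le> (\<Sum>k<m. real (Suc k) * (2 * real m / (real n - 1)) ^ Suc k)"
      by (rule expectation_num_frozen_le[OF n])
    also have "\<dots> \<le> (\<Sum>k<m. real (Suc k) * r ^ k)"
    proof (intro sum_mono mult_left_mono)
      fix k
      have "(2 * real m / (real n - 1)) ^ Suc k \<le> r ^ Suc k"
        using q n by (intro power_mono) auto
      \<comment> \<open>A factor \<open>r\<close> is given away to match the form of the
        series.\<close>
      also have "\<dots> \<le> r ^ k" using r by (intro power_decreasing) auto
      finally show "(2 * real m / (real n - 1)) ^ Suc k \<le> r ^ k" .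
    qed simp
    also have "\<dots> \<le> (\<Sum>k. real (Suc k) * r ^ k)"
      using sums r by (intro sum_le_suminf) (auto simp: sums_iff)
    also have "\<dots> = 1 / (1 - r)\<^sup>2" using sums by (simp add: sums_iff)
    also have "\<dots> \<le> B" using r by (simp add: B_def)
    finally show ?thesis by (simp add: m_def)
  qed
  moreover have "0 < B" using r by (auto simp: B_def intro!: add_pos_nonneg)
  ultimately show ?thesis by blast
qed

text \<open>Markov's inequality turns the bound on the expectations, uniform in \<open>n\<close>,
  into tightness. The shift by two starts the sequence at \<open>n = 2\<close>, the first size of
  the model.\<close>

theorem proposition1p4:
  fixes p t :: real
  assumes "0 < p" and "p \<le> 1" and "0 \<le> t" and "t < 1 / 2"
  shows "tight (\<lambda>k. num_frozen_law p (k + 2) (nat \<lfloor>real (k + 2) * t\<rfloor>))"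
  unfolding tight_def
proof (intro conjI allI impI)
  fix k
  interpret P: prob_space "frozen_space p (k + 2)" by (rule prob_space_frozen_space)
  show "real_distribution (num_frozen_law p (k + 2) (nat \<lfloor>real (k + 2) * t\<rfloor>))"
    unfolding num_frozen_law_def by (rule P.real_distribution_distr) measurable
next
  fix \<epsilon> :: real assume "0 < \<epsilon>"
  obtain B where "0 < B" and B: "\<And>n. 2 \<le> n \<Longrightarrow>
      (\<integral>\<omega>. real (num_frozen n (nat \<lfloor>real n * t\<rfloor>) \<omega>) \<partial>frozen_space p n) \<le> B"
    using expectation_num_frozen_bounded[OF assms(3,4)] by blast
  \<comment> \<open>With this choice Markov's bound \<open>B / b\<close> equals half of
    \<open>\<epsilon>\<close>.\<close>
  define b where "b = 2 * B / \<epsilon>"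
  have "0 < b" using \<open>0 < B\<close> \<open>0 < \<epsilon>\<close> by (simp add: b_def)
  \<comment> \<open>The intervals are open on the left, so the left end -1 keeps the value 0
    inside.\<close>
  have "1 - \<epsilon> < measure (num_frozen_law p (k + 2) (nat \<lfloor>real (k + 2) * t\<rfloor>)) {- 1<..b}" for k
  proof -
    let ?n = "k + 2"
    let ?G = "\<lambda>\<omega>. real (num_frozen ?n (nat \<lfloor>real ?n * t\<rfloor>) \<omega>)"
    interpret P: prob_space "frozen_space p ?n" by (rule prob_space_frozen_space)
    have G [measurable]: "?G \<in> borel_measurable (frozen_space p ?n)" by measurable
    have "P.prob {\<omega> \<in> space (frozen_space p ?n). b \<le> ?G \<omega>}
        \<le> (\<integral>\<omega>. ?G \<omega> \<partial>frozen_space p ?n) / b"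
      using \<open>0 < b\<close> by (intro integral_Markov_inequality_measure[where A = "{}"] integrable_num_frozen) auto
    also have "\<dots> \<le> B / b" using B[of ?n] \<open>0 < b\<close> by (intro divide_right_mono) auto
    also have "\<dots> < \<epsilon>" using \<open>0 < B\<close> \<open>0 < \<epsilon>\<close> by (simp add: b_def)
    finally have "1 - \<epsilon> < 1 - P.prob {\<omega> \<in> space (frozen_space p ?n). b \<le> ?G \<omega>}" by simp
    also have "\<dots> = P.prob (space (frozen_space p ?n) - {\<omega> \<in> space (frozen_space p ?n). b \<le> ?G \<omega>})"
      by (intro P.prob_compl[symmetric]) measurable
    also have "\<dots> \<le> P.prob (?G -` {- 1<..b} \<inter> space (frozen_space p ?n))"
      using measurable_sets[OF G, of "{- 1<..b}"] by (intro P.finite_measure_mono) auto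
    also have "\<dots> = measure (num_frozen_law p ?n (nat \<lfloor>real ?n * t\<rfloor>)) {- 1<..b}"
      unfolding num_frozen_law_def by (intro measure_distr[symmetric]) auto
    finally show ?thesis .
  qed
  moreover have "- 1 < b" using \<open>0 < b\<close> by simp
  ultimately show "\<exists>a b. a < b \<and>
      (\<forall>k. 1 - \<epsilon> < measure (num_frozen_law p (k + 2) (nat \<lfloor>real (k + 2) * t\<rfloor>)) {a<..b})"
    by blast
qed

end
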